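(* For every positive integer $n$, $|\mathcal{ODDP}_n| = 2^{n+1}-(n+1)$.
   Context: $X_n=\{1,2,\ldots,n\}$ and $\mathcal{I}_n$ is the symmetric inverse semigroup of all partial one-to-one maps of $X_n$ (including the empty map), with maps written on the right of their arguments. A map $\alpha\in\mathcal{I}_n$ is a partial isometry if $|x-y|=|x\alpha-y\alpha|$ for all $x,y\in\operatorname{Dom}\alpha$; it is order-decreasing if $x\alpha\leq x$ for all $x\in\operatorname{Dom}\alpha$; it is order-preserving if $x\leq y$ implies $x\alpha\leq y\alpha$ for all $x,y\in\operatorname{Dom}\alpha$. $\mathcal{ODDP}_n$ is the semigroup of all order-preserving, order-decreasing partial isometries of $X_n$. *)

theory Defs
  imports Main
begin

text \<open>
  Partial maps of \<open>{1..n}\<close> are represented as \<open>nat \<rightharpoonup> nat\<close> with domain and range inside \<open>{1..n}\<close>,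
  so that distinct representatives are distinct partial maps.
\<close>

definition X :: "nat \<Rightarrow> nat set" where
  "X n = {1..n}"

definition sym_inv_semigroup :: "nat \<Rightarrow> (nat \<rightharpoonup> nat) set" where
  "sym_inv_semigroup n = {\<alpha>. dom \<alpha> \<subseteq> X n \<and> ran \<alpha> \<subseteq> X n \<and> inj_on \<alpha> (dom \<alpha>)}"

text \<open>Distances are taken in \<open>int\<close>, since subtraction on \<open>nat\<close> truncates.\<close>

definition partial_isometry :: "(nat \<rightharpoonup> nat) \<Rightarrow> bool" where
  "partial_isometry \<alpha> \<longleftrightarrow>
     (\<forall>x\<in>dom \<alpha>. \<forall>y\<in>dom \<alpha>. \<bar>int x - int y\<bar> = \<bar>int (the (\<alpha> x)) - int (the (\<alpha> y))\<bar>)"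

definition order_decreasing :: "(nat \<rightharpoonup> nat) \<Rightarrow> bool" where
  "order_decreasing \<alpha> \<longleftrightarrow> (\<forall>x\<in>dom \<alpha>. the (\<alpha> x) \<le> x)"

definition order_preserving :: "(nat \<rightharpoonup> nat) \<Rightarrow> bool" where
  "order_preserving \<alpha> \<longleftrightarrow> (\<forall>x\<in>dom \<alpha>. \<forall>y\<in>dom \<alpha>. x \<le> y \<longrightarrow> the (\<alpha> x) \<le> the (\<alpha> y))"

definition ODDP :: "nat \<Rightarrow> (nat \<rightharpoonup> nat) set" where
  "ODDP n = {\<alpha> \<in> sym_inv_semigroup n.
     order_preserving \<alpha> \<and> order_decreasing \<alpha> \<and> partial_isometry \<alpha>}"

end

theory Submission imports Defs begin

text \<open>
  A distance-preserving map that also preserves the order satisfies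
  \<open>y\<alpha> - x\<alpha> = y - x\<close>, so \<open>x - x\<alpha>\<close> takes one value \<open>k\<close> on the whole domain: the map is a
  translation. The map is order-decreasing exactly when this translation goes to the left,
  \<open>k \<ge> 0\<close>, and its values are positive exactly when its domain lies in \<open>{k+1..n}\<close>. Conversely,
  every such translation is in the semigroup (\<open>ODDP_eq_left_translations\<close>).

  A nonempty map determines both \<open>k\<close> and its domain, so for each \<open>k < n\<close> there are
  \<open>2 ^ (n - k) - 1\<close> nonempty maps that shift by \<open>k\<close>. The empty map is a translation by every
  \<open>k\<close> and is counted once, separately. Summing the geometric progression gives
  \<open>(2 ^ (n + 1) - 2 - n) + 1\<close>.
\<close>

definition left_translation :: "nat \<Rightarrow> nat set \<Rightarrow> (nat \<rightharpoonup> nat)" where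
  "left_translation k A = (\<lambda>x. if x \<in> A then Some (x - k) else None)"

lemma dom_left_translation: "dom (left_translation k A) = A"
  by (auto simp: left_translation_def dom_def)

lemma left_translation_in_ODDP:
  assumes "A \<subseteq> {k+1..n}"
  shows "left_translation k A \<in> ODDP n"
proof -
  have A: "k < x \<and> x \<le> n" if "x \<in> A" for x
    using assms that by auto
  have the_val: "the (left_translation k A x) = x - k" if "x \<in> A" for x
    using that by (simp add: left_translation_def)
  have "ran (left_translation k A) \<subseteq> X n"
    using A by (fastforce simp: ran_def left_translation_def X_def split: if_splits)
  moreover have "A \<subseteq> X n"
    using A by (force simp: X_def)
  moreover have "inj_on (left_translation k A) A"
  proof (rule inj_onI)
    fix x y
    assume "x \<in> A" "y \<in> A" "left_translation k A x = left_translation k A y"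
    then show "x = y"
      using A[of x] A[of y] by (auto simp: left_translation_def)
  qed
  moreover have "partial_isometry (left_translation k A)"
    unfolding partial_isometry_def dom_left_translation
  proof (intro ballI)
    fix x y
    assume "x \<in> A" "y \<in> A"
    then show "\<bar>int x - int y\<bar> =
        \<bar>int (the (left_translation k A x)) - int (the (left_translation k A y))\<bar>"
      using A[of x] A[of y] by (simp add: the_val of_nat_diff)
  qed
  ultimately show ?thesis
    by (simp add: ODDP_def sym_inv_semigroup_def order_preserving_def order_decreasing_def
        dom_left_translation the_val diff_le_mono)
qed

text \<open>
  Preserving the order removes the absolute values from the isometry condition, so the
  amount by which points move is constant. It can be read off at any point of the domain.
\<close>

lemma ODDP_imp_left_translation:
  assumes \<alpha>: "\<alpha> \<in> ODDP n" and x: "x \<in> dom \<alpha>"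
  defines "k \<equiv> x - the (\<alpha> x)"
  shows "\<alpha> = left_translation k (dom \<alpha>)" and "k < n" and "dom \<alpha> \<subseteq> {k+1..n}"
proof -
  have range: "1 \<le> the (\<alpha> y) \<and> the (\<alpha> y) \<le> y \<and> y \<le> n" if "y \<in> dom \<alpha>" for y
  proof -
    have "the (\<alpha> y) \<in> ran \<alpha>"
      using that by (auto intro: ranI)
    then show ?thesis
      using \<alpha> that by (auto simp: ODDP_def sym_inv_semigroup_def order_decreasing_def X_def)
  qed
  have shift: "the (\<alpha> y) + k = y" if y: "y \<in> dom \<alpha>" for y
  proof -
    have iso: "\<bar>int x - int y\<bar> = \<bar>int (the (\<alpha> x)) - int (the (\<alpha> y))\<bar>"
      using \<alpha> x y by (simp add: ODDP_def partial_isometry_def)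
    have mono: "x \<le> y \<longrightarrow> the (\<alpha> x) \<le> the (\<alpha> y)" "y \<le> x \<longrightarrow> the (\<alpha> y) \<le> the (\<alpha> x)"
      using \<alpha> x y by (simp_all add: ODDP_def order_preserving_def)
    show ?thesis
      using iso mono range[OF x] unfolding k_def by linarith
  qed
  show "\<alpha> = left_translation k (dom \<alpha>)"
  proof
    fix y
    show "\<alpha> y = left_translation k (dom \<alpha>) y"
    proof (cases "y \<in> dom \<alpha>")
      case True
      then show ?thesis
        using shift[OF True] by (auto simp: left_translation_def)
    qed (auto simp: left_translation_def)
  qed
  show "k < n"
    using range[OF x] shift[OF x] by linarith
  show "dom \<alpha> \<subseteq> {k+1..n}"
  proof
    fix y
    assume "y \<in> dom \<alpha>"
    then show "y \<in> {k+1..n}"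
      using range[of y] shift[of y] by simp
  qed
qed

lemma ODDP_eq_left_translations:
  "ODDP n = insert Map.empty
     ((\<lambda>(k, A). left_translation k A) ` (SIGMA k:{..<n}. Pow {k+1..n} - {{}}))"
    (is "_ = insert _ (?f ` ?S)")
proof (intro subset_antisym subsetI)
  fix \<alpha>
  assume \<alpha>: "\<alpha> \<in> ODDP n"
  show "\<alpha> \<in> insert Map.empty (?f ` ?S)"
  proof (cases "dom \<alpha> = {}")
    case True
    then show ?thesis by simp
  next
    case False
    then obtain x where x: "x \<in> dom \<alpha>" by blast
    let ?k = "x - the (\<alpha> x)"
    note translation = ODDP_imp_left_translation[OF \<alpha> x]
    have "(?k, dom \<alpha>) \<in> ?S"
      using translation(2,3) False by simp
    moreover have "\<alpha> = ?f (?k, dom \<alpha>)"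
      using translation(1) by simp
    ultimately show ?thesis by blast
  qed
next
  fix \<alpha>
  assume "\<alpha> \<in> insert Map.empty (?f ` ?S)"
  moreover have "Map.empty \<in> ODDP n"
    using left_translation_in_ODDP[of "{}" 0 n] by (simp add: left_translation_def)
  ultimately show "\<alpha> \<in> ODDP n"
    using left_translation_in_ODDP by fastforce
qed

text \<open>
  The truncated subtraction in \<open>left_translation\<close> forgets \<open>k\<close> at points below \<open>k\<close>, and an
  empty domain forgets \<open>k\<close> altogether; neither occurs on this index set.
\<close>

lemma inj_on_left_translation:
  "inj_on (\<lambda>(k, A). left_translation k A) (SIGMA k:{..<n}. Pow {k+1..n} - {{}})"
    (is "inj_on ?f ?S")
proof (rule inj_onI)
  fix p q
  assume p: "p \<in> ?S" and q: "q \<in> ?S" and "?f p = ?f q"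
  obtain k A l B where pq: "p = (k, A)" "q = (l, B)"
    by fastforce
  then have A: "A \<subseteq> {k+1..n}" and B: "B \<subseteq> {l+1..n}" and "A \<noteq> {}"
    and eq: "left_translation k A = left_translation l B"
    using p q \<open>?f p = ?f q\<close> by auto
  have "A = B"
    using eq dom_left_translation by metis
  obtain x where x: "x \<in> A"
    using \<open>A \<noteq> {}\<close> by blast
  have "x - k = x - l"
    using fun_cong[OF eq, of x] x \<open>A = B\<close> by (simp add: left_translation_def)
  moreover have "k < x" "l < x"
    using A B x \<open>A = B\<close> by auto
  ultimately show "p = q"
    using \<open>A = B\<close> pq by simp
qed

lemma sum_nonempty_subset_counts:
  "(\<Sum>k<n. 2 ^ (n - k) - 1 :: int) = 2 ^ (n + 1) - 2 - int n"
proof (induction n)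
  case (Suc n)
  have "(\<Sum>k<Suc n. 2 ^ (Suc n - k) - 1 :: int) = (2 ^ Suc n - 1) + (\<Sum>k<n. 2 ^ (n - k) - 1)"
    by (subst sum.lessThan_Suc_shift) simp
  then show ?case
    using Suc.IH by simp
qed simp

theorem theorem2p4:
  fixes n :: nat
  assumes "n \<ge> 1"
  shows "int (card (ODDP n)) = 2 ^ (n + 1) - (int n + 1)"
proof -
  let ?S = "SIGMA k:{..<n}. Pow {k+1..n} - {{}}"
  let ?f = "\<lambda>(k, A). left_translation k A"
  have "Map.empty \<notin> ?f ` ?S"
  proof
    assume "Map.empty \<in> ?f ` ?S"
    then obtain k A where "Map.empty = left_translation k A" "A \<noteq> {}" by auto
    then show False
      using dom_left_translation[of k A] by (metis dom_empty)
  qed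
  moreover have "finite ?S"
    by (intro finite_SigmaI) auto
  ultimately have "card (ODDP n) = Suc (card ?S)"
    unfolding ODDP_eq_left_translations
    using card_image[OF inj_on_left_translation[of n]] by (simp del: card_SigmaI)
  moreover have "int (card ?S) = (\<Sum>k<n. 2 ^ (n - k) - 1)"
    by (simp add: card_Diff_singleton card_Pow of_nat_diff)
  ultimately show ?thesis
    using sum_nonempty_subset_counts[of n] by simp
qed

end
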